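(* Let $r,s,t$ be pairwise distinct positive integers and $n=r+s+t$. The Shabat polynomials for the family of the two trees with passport $[r,s,t;3,1^{n-3};n]$ are given by $$P(x)=x^r(x-1)^s(x-a)^t,$$ where $$a=\frac{r^2+rs+rt+st\mp 2\sqrt{-rst(r+s+t)}}{(r+s)^2}.$$
   Context: A Shabat polynomial is a complex polynomial with at most two finite critical values $c_1,c_2$; Shabat polynomials are considered up to affine changes of variable in the source and in the target (carrying critical values to critical values). The tree of a Shabat polynomial $P$ is the bicolored plane tree $P^{-1}([c_1,c_2])$, with black vertices the points of $P^{-1}(c_1)$, white vertices the points of $P^{-1}(c_2)$, edges the connected components of the preimage of the open segment $(c_1,c_2)$, and the degree of a vertex equal to the multiplicity of the corresponding root of $P-c_1$ or $P-c_2$. Bicolored plane trees correspond bijectively to Shabat polynomials up to this equivalence. The passport $[\alpha;\beta;n]$ of a tree with $n$ edges records the partition $\alpha\vdash n$ of black vertex degrees and the partition $\beta\vdash n$ of white vertex degrees ($k^m$ means $k$ repeated $m$ times). For pairwise distinct $r,s,t$ there are exactly two trees with passport $[r,s,t;3,1^{n-3};n]$. In the claim, $c_1=0$ (black vertices are the roots of $P$).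
   Formalization: The printed formula for a is false (for r,s,t=1,2,3 no white vertex of degree 3 arises); the term +st in the numerator is corrected to -st, so a=(r^2+rs+rt-st ∓ 2 sqrt(-rst(r+s+t)))/(r+s)^2. *)

theory Defs
  imports
    "HOL-Analysis.Analysis"
    "HOL-Computational_Algebra.Computational_Algebra"
begin

text \<open>
  The values \<open>c1\<close>, \<open>c2\<close> are part of the data: they are ordered (black, white), and
  they are determined by the polynomial only if both are really critical (for \<open>x ^ n\<close>
  one of them is arbitrary).
\<close>

definition shabat :: "complex poly \<Rightarrow> complex \<Rightarrow> complex \<Rightarrow> bool" where
  "shabat P c1 c2 \<longleftrightarrow>
     degree P > 0 \<and> c1 \<noteq> c2 \<and>
     (\<forall>z. poly (pderiv P) z = 0 \<longrightarrow> poly P z = c1 \<or> poly P z = c2)"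

text \<open>
  Equivalence up to affine changes of variable in source and target, where the target map
  carries \<open>c1\<close> to \<open>d1\<close> and \<open>c2\<close> to \<open>d2\<close>, so that the colours are preserved.
\<close>

definition shabat_equiv ::
  "complex poly \<times> complex \<times> complex \<Rightarrow> complex poly \<times> complex \<times> complex \<Rightarrow> bool" where
  "shabat_equiv = (\<lambda>(P, c1, c2) (Q, d1, d2).
     \<exists>u v w z. u \<noteq> 0 \<and> w \<noteq> 0 \<and>
       Q = smult w (pcompose P [:v, u:]) + [:z:] \<and>
       d1 = w * c1 + z \<and> d2 = w * c2 + z)"

record bicolored_tree =
  black_vertices :: "complex set"
  white_vertices :: "complex set"
  edges :: "complex set set"
  vertex_degree :: "complex \<Rightarrow> nat"

text \<open>
  The tree is the preimage of the segment from \<open>c1\<close> to \<open>c2\<close>, that is, the union of the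
  vertices and the edges below. The degree of a vertex \<open>v\<close> is its multiplicity
  as a root of \<open>P - P(v)\<close>.
\<close>

definition shabat_tree :: "complex poly \<Rightarrow> complex \<Rightarrow> complex \<Rightarrow> bicolored_tree" where
  "shabat_tree P c1 c2 =
     \<lparr> black_vertices = {z. poly P z = c1},
       white_vertices = {z. poly P z = c2},
       edges = components (poly P -` open_segment c1 c2),
       vertex_degree = (\<lambda>v. order v (P - [:poly P v:])) \<rparr>"

definition passport :: "bicolored_tree \<Rightarrow> nat multiset \<times> nat multiset \<times> nat" where
  "passport T =
     (image_mset (vertex_degree T) (mset_set (black_vertices T)),
      image_mset (vertex_degree T) (mset_set (white_vertices T)),
      card (edges T))"

definition shabat_family ::
  "nat multiset \<times> nat multiset \<times> nat \<Rightarrow> (complex poly \<times> complex \<times> complex) set" where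
  "shabat_family p = {(P, c1, c2). shabat P c1 c2 \<and> passport (shabat_tree P c1 c2) = p}"

definition three_root_poly :: "nat \<Rightarrow> nat \<Rightarrow> nat \<Rightarrow> complex \<Rightarrow> complex poly" where
  "three_root_poly r s t a = [:0, 1:] ^ r * [:-1, 1:] ^ s * [:-a, 1:] ^ t"

text \<open>
  With \<open>n = r + s + t\<close> and \<open>P = x^r (x-1)^s (x-a)^t\<close>, the numerator of \<open>P'/P\<close> is
  \<open>n x^2 - (r (1+a) + s a + t) x + r a\<close>. It has a double root (the white vertex of degree 3)
  iff \<open>(r + t + (r+s) a)^2 = 4 n r a\<close>; the two roots \<open>a\<close> of this quadratic equation are the
  values below, for \<open>e = -1\<close> and \<open>e = 1\<close>. In particular the term \<open>s t\<close> has a minus sign.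
\<close>

definition third_root :: "complex \<Rightarrow> nat \<Rightarrow> nat \<Rightarrow> nat \<Rightarrow> complex" where
  "third_root e r s t =
     (of_nat r ^ 2 + of_nat r * of_nat s + of_nat r * of_nat t - of_nat s * of_nat t
        + e * 2 * csqrt (- (of_nat r * of_nat s * of_nat t * (of_nat r + of_nat s + of_nat t))))
     / (of_nat r + of_nat s) ^ 2"

end

theory Submission
  imports Defs "HOL-Complex_Analysis.Conformal_Mappings"
begin

text \<open>
  Over the open segment between the two critical values a Shabat polynomial \<open>P\<close> has no critical
  point, so it restricts to a covering of degree \<open>deg P\<close>. The segment is simply connected, hence
  the components of its preimage correspond to the points of one fibre, and the tree always has
  \<open>deg P\<close> edges. The passport is therefore a condition on root multiplicities only. Since
  \<open>r\<close>, \<open>s\<close>, \<open>t\<close> are distinct, the three roots can be told apart, and a unique affine map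
  moves them to \<open>0\<close>, \<open>1\<close>, \<open>a\<close>. A white vertex of degree 3 means that the quadratic factor of
  \<open>P'\<close> has a double root, that is, that its discriminant vanishes; this is a quadratic equation
  for \<open>a\<close> whose two solutions are distinct.
\<close>

subsection \<open>Edges of the tree\<close>

text \<open>Over a simply connected base the identity lifts to a section through any prescribed
  point of \<open>C\<close>. The image of a section is connected and meets the fibre over
  \<open>y\<close>, which gives surjectivity; uniqueness of lifts gives injectivity.\<close>

lemma bij_betw_fibre_components:
  fixes p :: "'a::real_normed_vector \<Rightarrow> 'b::real_normed_vector"
  assumes cov: "covering_space C p S"
    and S: "simply_connected S" "locally path_connected S" and y: "y \<in> S"
  shows "bij_betw (connected_component_set C) {x \<in> C. p x = y} (components C)"
proof -
  have contp: "continuous_on C p" and pC: "p ` C = S"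
    using cov covering_space_imp_continuous covering_space_imp_surjective by blast+
  have lift: "\<exists>g. continuous_on S g \<and> g \<in> S \<rightarrow> C \<and> g (p x) = x \<and> (\<forall>z\<in>S. p (g z) = z)"
    if "x \<in> C" for x
  proof -
    have "p x \<in> S" using that pC by blast
    obtain g where "continuous_on S g" "g \<in> S \<rightarrow> C" "g (p x) = x" "\<And>z. z \<in> S \<Longrightarrow> p (g z) = z"
      by (rule covering_space_lift_strong[OF cov \<open>x \<in> C\<close> \<open>p x \<in> S\<close> S, where f = "\<lambda>z. z"]) auto
    then show ?thesis by blast
  qed
  show ?thesis
    unfolding bij_betw_def
  proof (intro conjI inj_onI set_eqI iffI)
    fix x x' assume x: "x \<in> {x \<in> C. p x = y}" and x': "x' \<in> {x \<in> C. p x = y}"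
      and eq: "connected_component_set C x = connected_component_set C x'"
    define K where "K = connected_component_set C x"
    have K: "connected K" "K \<subseteq> C" "x \<in> K"
      using x by (auto simp: K_def connected_component_subset connected_component_refl_eq)
    have "x' \<in> K" using x' eq by (auto simp: K_def connected_component_refl_eq)
    obtain g where g: "continuous_on S g" "g \<in> S \<rightarrow> C" "g (p x) = x" "\<forall>z\<in>S. p (g z) = z"
      using lift x by blast
    have pK: "p ` K \<subseteq> S" using K pC by blast
    have contK: "continuous_on K p" using contp K continuous_on_subset by blast
    \<comment> \<open>The inclusion and \<open>g \<circ> p\<close> are both lifts of \<open>p\<close> on \<open>K\<close>, and they agree at \<open>x\<close>.\<close>
    have "x' = (g \<circ> p) x'"
    proof (rule covering_space_lift_unique[OF cov, where T = K and f = p and a = x and ?g1.0 = "\<lambda>x. x"])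
      show "continuous_on K (g \<circ> p)"
        by (rule continuous_on_compose[OF contK continuous_on_subset[OF g(1) pK]])
      show "p \<in> K \<rightarrow> S" using pK by blast
      show "g \<circ> p \<in> K \<rightarrow> C" using pK funcset_mem[OF g(2)] by auto
      show "\<And>z. z \<in> K \<Longrightarrow> p z = p ((g \<circ> p) z)" using pK g(4) by auto
    qed (use K \<open>x' \<in> K\<close> contK g(3) in auto)
    also have "\<dots> = x" using x x' g(3) by simp
    finally show "x = x'" ..
  next
    fix K assume "K \<in> connected_component_set C ` {x \<in> C. p x = y}"
    then show "K \<in> components C" by (auto intro: componentsI)
  next
    fix K assume "K \<in> components C"
    then obtain z where z: "z \<in> C" "K = connected_component_set C z"
      by (auto elim: componentsE)
    obtain g where g: "continuous_on S g" "g \<in> S \<rightarrow> C" "g (p z) = z" "\<forall>w\<in>S. p (g w) = w"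
      using lift z by blast
    have "connected (g ` S)"
      using S(1) g(1) by (simp add: connected_continuous_image simply_connected_imp_connected)
    moreover have "g ` S \<subseteq> C" "z \<in> g ` S" "g y \<in> g ` S"
      using g z pC y by (auto simp: image_iff) (metis imageI)
    ultimately have "connected_component C z (g y)"
      unfolding connected_component_def by blast
    then have "K = connected_component_set C (g y)"
      using z(2) connected_component_eq by force
    moreover have "g y \<in> {x \<in> C. p x = y}" using g y by auto
    ultimately show "K \<in> connected_component_set C ` {x \<in> C. p x = y}" by blast
  qed
qed

section \<open>Fibres of a polynomial counted with multiplicity\<close>

lemma sum_order_complex:
  fixes p :: "complex poly"
  assumes "p \<noteq> 0"
  shows "(\<Sum>z | poly p z = 0. order z p) = degree p"
proof -
  have "size (proots p) = (\<Sum>z\<in>set_mset (proots p). count (proots p) z)"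
    by (rule size_multiset_overloaded_eq)
  then show ?thesis using assms by (simp add: size_proots_complex)
qed

lemma
  fixes p :: "'a::idom poly"
  assumes "degree p > 0"
  shows minus_const_nonzero: "p - [:c:] \<noteq> 0"
    and degree_minus_const: "degree (p - [:c:]) = degree p"
proof -
  show "degree (p - [:c:]) = degree p"
    using degree_add_eq_left[of "[:-c:]" p] assms by (simp add: diff_conv_add_uminus del: add_uminus_conv_diff)
  with assms show "p - [:c:] \<noteq> 0" by auto
qed

lemma finite_fibre:
  fixes p :: "'a::idom poly"
  assumes "degree p > 0"
  shows "finite {z. poly p z = c}"
  using poly_roots_finite[OF minus_const_nonzero[OF assms, of c]] by simp

lemma sum_order_fibre:
  fixes p :: "complex poly"
  assumes "degree p > 0"
  shows "(\<Sum>z | poly p z = c. order z (p - [:c:])) = degree p"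
  using sum_order_complex[OF minus_const_nonzero[OF assms, of c]] assms
  by (simp add: degree_minus_const)

text \<open>In characteristic 0 differentiation lowers the multiplicity of a root by exactly one.
  This turns vertex degrees into orders of zeros of the derivative.\<close>

lemma order_minus_const:
  fixes p :: "'a::field_char_0 poly"
  assumes "degree p > 0" "poly p z = c"
  shows "order z (p - [:c:]) = Suc (order z (pderiv p))"
  using order_pderiv[OF minus_const_nonzero[OF assms(1), of c], of z] assms(2)
  by (simp add: pderiv_diff pderiv_pCons)

lemma card_fibre_regular:
  fixes p :: "complex poly"
  assumes "degree p > 0" "\<And>z. poly p z = c \<Longrightarrow> poly (pderiv p) z \<noteq> 0"
  shows "card {z. poly p z = c} = degree p"
proof -
  have "order z (p - [:c:]) = 1" if "poly p z = c" for z
    using order_minus_const[OF assms(1) that] assms(2)[OF that] by (simp add: order_0I)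
  then show ?thesis
    using sum_order_fibre[OF assms(1), of c] by simp
qed

section \<open>Polynomials as coverings over regular values\<close>

lemma holomorphic_on_poly: "poly p holomorphic_on A"
  by (auto simp: holomorphic_on_def field_differentiable_def intro!: exI DERIV_subset[OF poly_DERIV])

text \<open>The sheets near \<open>y\<close> are cut out of small disjoint discs about the points of
  its fibre. They exhaust the preimage because every fibre over \<open>S\<close> has exactly
  \<open>degree p\<close> points.\<close>

lemma covering_space_poly:
  fixes p :: "complex poly"
  assumes deg: "degree p > 0"
    and reg: "\<And>z. poly p z \<in> S \<Longrightarrow> poly (pderiv p) z \<noteq> 0"
  shows "covering_space (poly p -` S) (poly p) S"
proof
  show "continuous_on (poly p -` S) (poly p)" by (intro continuous_intros)
  have surj: "\<exists>z. poly p z = y" for y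
  proof -
    have "degree (p - [:y:]) > 0" using deg by (simp add: degree_minus_const)
    from alg_closed_imp_poly_has_root[OF this] show ?thesis by auto
  qed
  show "poly p ` (poly p -` S) = S"
    using surj by (auto simp: image_iff) metis
next
  fix y assume y: "y \<in> S"
  define F where "F = {z. poly p z = y}"
  have F: "finite F" "card F = degree p"
    unfolding F_def using finite_fibre[OF deg] card_fibre_regular[OF deg] reg y by auto
  have "\<exists>r>0. inj_on (poly p) (ball x r)" if "x \<in> F" for x
  proof -
    have "deriv (poly p) x \<noteq> 0" using that reg y by (simp add: F_def DERIV_imp_deriv[OF poly_DERIV])
    then show ?thesis
      using has_complex_derivative_locally_invertible[of "poly p" UNIV x]
      by (metis UNIV_I holomorphic_on_poly open_UNIV)
  qed
  then obtain r where r: "\<And>x. x \<in> F \<Longrightarrow> r x > 0 \<and> inj_on (poly p) (ball x (r x))"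
    by metis
  obtain d where d: "d > 0" "\<And>x x'. x \<in> F \<Longrightarrow> x' \<in> F \<Longrightarrow> dist x x' < d \<Longrightarrow> x = x'"
    using F(1) uniform_discrete_finite_iff unfolding uniform_discrete_def by metis
  \<comment> \<open>The radius \<open>r x\<close> ensures injectivity; half the separation
    \<open>d\<close> of the fibre makes the discs disjoint.\<close>
  define U where "U = (\<lambda>x. ball x (min (r x) (d / 2)))"
  have openU: "open (U x)" for x by (simp add: U_def)
  have xU: "x \<in> U x" if "x \<in> F" for x using r[OF that] d(1) by (simp add: U_def)
  have injU: "inj_on (poly p) (U x)" if "x \<in> F" for x
    using r[OF that] by (auto simp: U_def intro: inj_on_subset)
  have disjU: "x = x'" if "x \<in> F" "x' \<in> F" "z \<in> U x" "z \<in> U x'" for x x' z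
  proof (rule d(2)[OF that(1,2)])
    show "dist x x' < d"
      using that(3,4) dist_triangle_half_l[of x z d x'] by (simp add: U_def)
  qed
  have holU: "poly p holomorphic_on U x" for x by (rule holomorphic_on_poly)
  have openpU: "open (poly p ` U x)" if "x \<in> F" for x
    using open_mapping_thm3[OF holU openU injU[OF that]] .
  \<comment> \<open>These are the values in \<open>S\<close> attained in every disc, so each sheet
    maps onto all of \<open>T\<close>.\<close>
  define T where "T = S \<inter> (\<Inter>x\<in>F. poly p ` U x)"
  define W where "W = (\<lambda>x. U x \<inter> poly p -` T)"
  have "y \<in> T" using y xU by (auto simp: T_def F_def)
  moreover have "openin (top_of_set S) T"
    unfolding T_def using F(1) openpU by (intro openin_open_Int open_INT) auto
  moreover have "\<Union>(W ` F) = poly p -` S \<inter> poly p -` T"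
  proof (intro equalityI subsetI)
    fix z assume z: "z \<in> poly p -` S \<inter> poly p -` T"
    then have "\<forall>x\<in>F. \<exists>w\<in>U x. poly p w = poly p z" by (force simp: T_def)
    then obtain h where h: "\<And>x. x \<in> F \<Longrightarrow> h x \<in> U x \<and> poly p (h x) = poly p z" by metis
    have "inj_on h F" using h disjU by (metis inj_onI)
    \<comment> \<open>The fibre over \<open>poly p z\<close> has only \<open>degree p\<close> points, so all of them are near \<open>F\<close>.\<close>
    then have "card (h ` F) = card {w. poly p w = poly p z}"
      using F(2) card_fibre_regular[OF deg] reg z by (simp add: card_image)
    moreover have "h ` F \<subseteq> {w. poly p w = poly p z}" using h by auto
    ultimately have "h ` F = {w. poly p w = poly p z}"
      using finite_fibre[OF deg] by (intro card_subset_eq)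
    then have "z \<in> h ` F" by blast
    then obtain x where "x \<in> F" "z \<in> U x" using h by blast
    then show "z \<in> \<Union>(W ` F)" using z by (auto simp: W_def)
  qed (auto simp: W_def T_def)
  moreover have "openin (top_of_set (poly p -` S)) (W x)" if "x \<in> F" for x
  proof -
    have "open ((\<Inter>x\<in>F. poly p ` U x))" using F(1) openpU by auto
    then have "open (U x \<inter> poly p -` (\<Inter>x\<in>F. poly p ` U x))"
      by (intro open_Int openU open_vimage) (auto intro!: continuous_intros)
    moreover have "W x = poly p -` S \<inter> (U x \<inter> poly p -` (\<Inter>x\<in>F. poly p ` U x))"
      by (auto simp: W_def T_def)
    ultimately show ?thesis by auto
  qed
  moreover have "pairwise disjnt (W ` F)"
    using disjU by (fastforce simp: pairwise_def disjnt_def W_def)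
  moreover have "\<exists>q. homeomorphism (W x) T (poly p) q" if "x \<in> F" for x
  proof -
    have "continuous_on (U x) (poly p)" by (intro continuous_intros)
    then obtain g where hom: "homeomorphism (U x) (poly p ` U x) (poly p) g"
      using invariance_of_domain_homeomorphism[OF openU _ _ injU[OF \<open>x \<in> F\<close>]] by blast
    have sub: "T \<subseteq> poly p ` U x" using \<open>x \<in> F\<close> by (auto simp: T_def)
    then have "poly p ` W x = T" unfolding W_def by blast
    then have "homeomorphism (W x) T (poly p) g"
      by (intro homeomorphism_of_subsets[OF hom _ sub]) (auto simp: W_def)
    then show ?thesis by blast
  qed
  ultimately show "\<exists>T. y \<in> T \<and> openin (top_of_set S) T \<and>
      (\<exists>v. \<Union>v = poly p -` S \<inter> poly p -` T \<and> (\<forall>u\<in>v. openin (top_of_set (poly p -` S)) u) \<and>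
        pairwise disjnt v \<and> (\<forall>u\<in>v. \<exists>q. homeomorphism u T (poly p) q))"
    by (intro exI[of _ T] conjI exI[of _ "W ` F"]) auto
qed

lemma card_components_poly_vimage:
  fixes p :: "complex poly"
  assumes deg: "degree p > 0" and "convex S" "S \<noteq> {}"
    and reg: "\<And>z. poly p z \<in> S \<Longrightarrow> poly (pderiv p) z \<noteq> 0"
  shows "card (components (poly p -` S)) = degree p"
proof -
  obtain y where y: "y \<in> S" using assms by blast
  have "{z \<in> poly p -` S. poly p z = y} = {z. poly p z = y}" using y by auto
  with bij_betw_same_card[OF bij_betw_fibre_components[OF covering_space_poly[OF deg reg] _ _ y]]
  show ?thesis
    using card_fibre_regular[OF deg] reg y \<open>convex S\<close>
    by (metis convex_imp_locally_path_connected convex_imp_simply_connected)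
qed

subsection \<open>Three roots and a white vertex of degree 3\<close>

lemma pcompose_power: "pcompose (p ^ n) q = pcompose p q ^ n"
  by (induction n) (simp_all add: pcompose_mult pcompose_1)

text \<open>The substitution turns the factor at \<open>v + u * x\<close> into a nonzero multiple of
  the factor at \<open>x\<close>, while the cofactor stays nonzero there.\<close>

lemma order_pcompose_linear:
  fixes p :: "'a::field_char_0 poly"
  assumes "p \<noteq> 0" "u \<noteq> 0"
  shows "order x (pcompose p [:v, u:]) = order (v + u * x) p"
proof -
  define y k where "y = v + u * x" and "k = order y p"
  obtain g where g: "p = [:-y, 1:] ^ k * g" "\<not> [:-y, 1:] dvd g"
    using order_decomp[OF assms(1)] unfolding k_def by blast
  have "pcompose [:-y, 1:] [:v, u:] = smult u [:-x, 1:]" by (simp add: pcompose_pCons y_def)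
  then have eq: "pcompose p [:v, u:] = smult (u ^ k) ([:-x, 1:] ^ k * pcompose g [:v, u:])"
    by (simp only: g(1) pcompose_mult pcompose_power smult_power mult_smult_left)
  have "poly (pcompose g [:v, u:]) x \<noteq> 0"
    using g(2) by (simp add: poly_pcompose y_def poly_eq_0_iff_dvd mult.commute)
  moreover from this have "pcompose g [:v, u:] \<noteq> 0" by auto
  ultimately show ?thesis
    using assms(2) unfolding eq
    by (simp add: order_smult order_mult order_power_n_n order_0I k_def y_def)
qed

lemma order_linear_power:
  "order x ([:-y, 1:] ^ n :: 'a::idom poly) = (if x = y then n else 0)"
  by (auto simp: order_power_n_n intro: order_0I)

lemma three_root_poly_nonzero [simp]: "three_root_poly r s t a \<noteq> 0"
  by (simp add: three_root_poly_def)

lemma degree_three_root_poly: "degree (three_root_poly r s t a) = r + s + t"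
  by (simp add: three_root_poly_def degree_mult_eq degree_power_eq)

lemma poly_three_root_poly: "poly (three_root_poly r s t a) z = z ^ r * (z - 1) ^ s * (z - a) ^ t"
  by (simp add: three_root_poly_def)

text \<open>The contributions are added rather than listed by cases, so the formula also holds when
  \<open>a\<close> is 0 or 1.\<close>

lemma order_three_root_poly:
  "order z (three_root_poly r s t a) =
    (if z = 0 then r else 0) + (if z = 1 then s else 0) + (if z = a then t else 0)"
  using order_linear_power[of z 0 r]
  by (simp add: three_root_poly_def order_mult order_linear_power del: mult_pCons_left mult_pCons_right)

section \<open>The quadratic factor of the derivative\<close>

text \<open>The numerator of the logarithmic derivative \<open>r/x + s/(x-1) + t/(x-a)\<close> over
  the common denominator \<open>x (x-1) (x-a)\<close>.\<close>

definition white_quadratic :: "nat \<Rightarrow> nat \<Rightarrow> nat \<Rightarrow> complex \<Rightarrow> complex poly" where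
  "white_quadratic r s t a =
    [:of_nat r * a, - (of_nat r * (1 + a) + of_nat s * a + of_nat t), of_nat (r + s + t):]"

lemma pderiv_linear_power: "pderiv ([:c, 1:] ^ Suc n) = smult (of_nat (Suc n)) ([:c, 1:] ^ n)"
  by (simp add: pderiv_power_Suc pderiv_pCons del: power_Suc)

lemma pderiv_three_root_poly:
  assumes "r > 0" "s > 0" "t > 0"
  shows "pderiv (three_root_poly r s t a) =
    three_root_poly (r - 1) (s - 1) (t - 1) a * white_quadratic r s t a"
proof -
  \<comment> \<open>With successors as exponents the truncated differences such as
    \<open>r - 1\<close> are exact.\<close>
  obtain r' s' t' where "r = Suc r'" "s = Suc s'" "t = Suc t'"
    using assms gr0_implies_Suc by metis
  then show ?thesis
    by (intro poly_eq_poly_eq_iff[THEN iffD1] ext)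
       (simp only: three_root_poly_def pderiv_mult pderiv_linear_power white_quadratic_def,
        simp add: algebra_simps)
qed


text \<open>The midpoint of the two roots of \<open>white_quadratic\<close>, hence the only
  candidate for a double root.\<close>

definition white_point :: "nat \<Rightarrow> nat \<Rightarrow> nat \<Rightarrow> complex \<Rightarrow> complex" where
  "white_point r s t a =
    (of_nat r * (1 + a) + of_nat s * a + of_nat t) / (2 * of_nat (r + s + t))"

text \<open>The discriminant of \<open>white_quadratic\<close> vanishes.\<close>

definition white_condition :: "nat \<Rightarrow> nat \<Rightarrow> nat \<Rightarrow> complex \<Rightarrow> bool" where
  "white_condition r s t a \<longleftrightarrow>
    (of_nat r * (1 + a) + of_nat s * a + of_nat t)\<^sup>2 = 4 * of_nat (r + s + t) * of_nat r * a"

lemma white_quadratic_double_root: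
  assumes "r > 0"
    and "poly (white_quadratic r s t a) z = 0" "poly (pderiv (white_quadratic r s t a)) z = 0"
  shows "white_condition r s t a" and "z = white_point r s t a"
proof -
  define n b where "n = (of_nat (r + s + t) :: complex)"
    and "b = of_nat r * (1 + a) + of_nat s * a + of_nat t"
  have n: "n \<noteq> 0" using assms(1) by (simp add: n_def del: of_nat_add)
  \<comment> \<open>The first equation is the vanishing derivative, the second the vanishing
    value.\<close>
  have "b = 2 * n * z" "of_nat r * a = b * z - n * z * z"
    using assms(2,3)
    unfolding white_quadratic_def
    by (simp_all only: flip: n_def b_def) (simp_all add: pderiv_pCons algebra_simps)
  moreover have "b\<^sup>2 = 4 * n * (b * z - n * z * z)"
    unfolding \<open>b = 2 * n * z\<close> by (simp add: power2_eq_square algebra_simps)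
  ultimately have "b\<^sup>2 = 4 * n * of_nat r * a" "z = b / (2 * n)"
    using n by (simp_all add: mult.assoc)
  then show "white_condition r s t a" "z = white_point r s t a"
    unfolding white_condition_def white_point_def n_def b_def by blast+
qed

lemma white_quadratic_eq_square:
  assumes "r > 0" "white_condition r s t a"
  shows "white_quadratic r s t a = smult (of_nat (r + s + t)) ([:- white_point r s t a, 1:] ^ 2)"
proof -
  define n b where "n = (of_nat (r + s + t) :: complex)"
    and "b = of_nat r * (1 + a) + of_nat s * a + of_nat t"
  have "n \<noteq> 0" using assms(1) by (simp add: n_def del: of_nat_add)
  moreover have "b * b = 4 * n * of_nat r * a"
    using assms(2) unfolding white_condition_def power2_eq_square n_def b_def .
  ultimately show ?thesis
    unfolding white_quadratic_def white_point_def
    by (simp only: flip: n_def b_def) (simp add: power2_eq_square field_simps)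
qed

text \<open>The condition is quadratic in \<open>a\<close> with leading coefficient
  \<open>(R + S)^2\<close> and linear coefficient \<open>-2 * m\<close>, which is where
  \<open>S * T\<close> acquires its minus sign. Multiplying by \<open>(R + S)^2\<close> completes
  the square.\<close>

lemma white_condition_iff:
  assumes "r > 0"
  shows "white_condition r s t a \<longleftrightarrow> a = third_root (-1) r s t \<or> a = third_root 1 r s t"
proof -
  define R S T d where "R = (of_nat r :: complex)" and "S = (of_nat s :: complex)"
    and "T = (of_nat t :: complex)" and "d = 2 * csqrt (- (R * S * T * (R + S + T)))"
  define m where "m = R ^ 2 + R * S + R * T - S * T"
  have RS: "R + S \<noteq> 0"
    using assms by (simp add: R_def S_def flip: of_nat_add)
  have d: "d\<^sup>2 = - 4 * (R * S * T * (R + S + T))"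
    by (simp add: d_def power_mult_distrib)
  have "(a * (R + S)\<^sup>2 - m)\<^sup>2 - d\<^sup>2 =
      (R + S)\<^sup>2 * ((R * (1 + a) + S * a + T)\<^sup>2 - 4 * (R + S + T) * R * a)"
    unfolding d m_def by algebra
  then have "white_condition r s t a \<longleftrightarrow> (a * (R + S)\<^sup>2 - m)\<^sup>2 = d\<^sup>2"
    using RS by (auto simp: white_condition_def R_def S_def T_def)
  \<comment> \<open>The factors \<open>-1\<close> and \<open>1\<close> are kept to match the
    parameter \<open>e\<close> of \<open>third_root\<close>.\<close>
  also have "\<dots> \<longleftrightarrow> a * (R + S)\<^sup>2 = m + (-1) * d \<or> a * (R + S)\<^sup>2 = m + 1 * d"
    by (auto simp: power2_eq_iff algebra_simps)
  also have "\<dots> \<longleftrightarrow> a = (m + (-1) * d) / (R + S)\<^sup>2 \<or> a = (m + 1 * d) / (R + S)\<^sup>2"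
    using RS by (auto simp: field_simps)
  finally show ?thesis
    by (simp add: third_root_def m_def d_def R_def S_def T_def)
qed

text \<open>The difference is a nonzero multiple of a square root whose radicand is nonzero.\<close>

lemma third_roots_distinct:
  assumes "r > 0" "s > 0" "t > 0"
  shows "third_root (-1) r s t \<noteq> third_root 1 r s t"
proof -
  have "(of_nat r + of_nat s :: complex) \<noteq> 0" "(of_nat r + of_nat s + of_nat t :: complex) \<noteq> 0"
    using assms by (simp_all flip: of_nat_add)
  then show ?thesis
    using assms by (simp add: third_root_def)
qed

text \<open>At \<open>a = 0\<close> the condition collapses to \<open>(r + t)^2 = 0\<close>, at
  \<open>a = 1\<close> to \<open>(s + t)^2 = 0\<close>.\<close>

lemma white_condition_nondegenerate:
  assumes "r > 0" "s > 0" "white_condition r s t a"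
  shows "a \<noteq> 0" "a \<noteq> 1"
proof -
  have "(of_nat r + of_nat t :: complex) \<noteq> 0" "(of_nat s + of_nat t :: complex) \<noteq> 0"
    using assms by (simp_all flip: of_nat_add)
  moreover have "(of_nat r + of_nat t :: complex)\<^sup>2 = 0" if "a = 0"
    using assms(3) that by (simp add: white_condition_def)
  moreover have "(of_nat s + of_nat t :: complex)\<^sup>2 = 0" if "a = 1"
    using assms(3) that
    by (simp add: white_condition_def power2_eq_square algebra_simps)
  ultimately show "a \<noteq> 0" "a \<noteq> 1" by auto
qed

section \<open>Passports, and membership of the normal forms in the family\<close>

text \<open>No critical value lies in the open segment, so the edge count is
  \<open>degree P\<close>; only multiplicities in the two vertex fibres remain.\<close>

lemma passport_shabat_tree:
  assumes "shabat P c1 c2"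
  shows "passport (shabat_tree P c1 c2) =
    (image_mset (\<lambda>z. order z (P - [:c1:])) (mset_set {z. poly P z = c1}),
     image_mset (\<lambda>z. order z (P - [:c2:])) (mset_set {z. poly P z = c2}), degree P)"
proof -
  have deg: "degree P > 0" and "c1 \<noteq> c2"
    and crit: "\<And>z. poly (pderiv P) z = 0 \<Longrightarrow> poly P z = c1 \<or> poly P z = c2"
    using assms by (auto simp: shabat_def)
  have "card (components (poly P -` open_segment c1 c2)) = degree P"
  proof (rule card_components_poly_vimage[OF deg])
    show "poly (pderiv P) z \<noteq> 0" if "poly P z \<in> open_segment c1 c2" for z
      using crit[of z] that by (auto simp: open_segment_def)
  qed (use \<open>c1 \<noteq> c2\<close> in \<open>auto\<close>)
  moreover have "image_mset (\<lambda>z. order z (P - [:poly P z:])) (mset_set {z. poly P z = c}) =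
      image_mset (\<lambda>z. order z (P - [:c:])) (mset_set {z. poly P z = c})" for c
    by (rule image_mset_cong) (use finite_fibre[OF deg] in auto)
  ultimately show ?thesis
    by (simp add: passport_def shabat_tree_def)
qed

text \<open>Every critical point is a black vertex or the double root \<open>w\<close> of the
  quadratic factor. Hence \<open>w\<close> has degree 3, and all other white vertices have degree
  1.\<close>

lemma three_root_poly_in_family:
  assumes "r > 0" "s > 0" "t > 0" and cond: "white_condition r s t a"
  defines "P \<equiv> three_root_poly r s t a" and "w \<equiv> white_point r s t a"
  shows "(P, 0, poly P w) \<in> shabat_family
    ({#r, s, t#}, add_mset 3 (replicate_mset (r + s + t - 3) 1), r + s + t)"
proof -
  define c W where "c = poly P w" and "W = {z. poly P z = c}"
  have deg: "degree P = r + s + t" "degree P > 0"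
    using assms by (simp_all add: P_def degree_three_root_poly)
  have a: "a \<noteq> 0" "a \<noteq> 1" using white_condition_nondegenerate cond assms(1,2) by blast+
  have roots: "poly P z = 0 \<longleftrightarrow> z = 0 \<or> z = 1 \<or> z = a" for z
    using assms(1-3) by (simp add: P_def poly_three_root_poly)
  have dP: "pderiv P = three_root_poly (r - 1) (s - 1) (t - 1) a *
      smult (of_nat (r + s + t)) ([:- w, 1:] ^ 2)"
    using assms(1-3) cond
    by (simp only: P_def pderiv_three_root_poly white_quadratic_eq_square w_def)
  \<comment> \<open>This separates \<open>w\<close> from the black vertices, so that the two
    critical values differ.\<close>
  have "poly (white_quadratic r s t a) z \<noteq> 0" if "z \<in> {0, 1, a}" for z
  proof -
    have "poly (white_quadratic r s t a) 0 = of_nat r * a"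
      "poly (white_quadratic r s t a) 1 = of_nat s * (1 - a)"
      "poly (white_quadratic r s t a) a = of_nat t * a * (a - 1)"
      by (simp_all add: white_quadratic_def algebra_simps)
    then show ?thesis using that a assms(1-3) by auto
  qed
  moreover have "poly (white_quadratic r s t a) w = 0"
    using assms(1) cond by (simp add: white_quadratic_eq_square w_def)
  ultimately have w: "w \<noteq> 0" "w \<noteq> 1" "w \<noteq> a" by auto
  then have "c \<noteq> 0" by (simp add: c_def roots)
  have crit: "z = w \<or> poly P z = 0" if "poly (pderiv P) z = 0" for z
    using that assms(1-3) unfolding dP
    by (auto simp: roots poly_three_root_poly simp del: of_nat_add)
  have shabat: "shabat P 0 c"
    unfolding shabat_def using deg \<open>c \<noteq> 0\<close> crit c_def by metis
  have "{z. poly P z = 0} = {0, 1, a}" using roots by auto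
  then have black: "image_mset (\<lambda>z. order z (P - [:0:])) (mset_set {z. poly P z = 0}) = {#r, s, t#}"
    using a by (simp add: P_def order_three_root_poly)
  have order_dP: "order z (pderiv P) = (if z = w then 2 else 0)" if "z \<in> W" for z
  proof -
    have "poly P z \<noteq> 0" using that \<open>c \<noteq> 0\<close> by (simp add: W_def)
    then have z: "z \<noteq> 0" "z \<noteq> 1" "z \<noteq> a" by (auto simp: roots)
    have n: "of_nat (r + s + t) \<noteq> (0 :: complex)" using assms(1) by (simp del: of_nat_add)
    show ?thesis
      using z n unfolding dP
      by (simp add: order_mult order_smult order_three_root_poly order_linear_power
          del: of_nat_add)
  qed
  have ord: "order z (P - [:c:]) = (if z = w then 3 else 1)" if "z \<in> W" for z
    using order_minus_const[OF deg(2), of z c] order_dP[OF that] that by (simp add: W_def)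
  have finW: "finite W" "w \<in> W"
    using finite_fibre[OF deg(2)] by (simp_all add: W_def c_def)
  \<comment> \<open>Counting the white fibre with multiplicity gives the number of leaves, and shows
    that subtracting 3 is not truncated.\<close>
  have "r + s + t = (\<Sum>z\<in>W. order z (P - [:c:]))"
    using sum_order_fibre[OF deg(2), of c] deg(1) by (simp add: W_def)
  also have "\<dots> = 3 + card (W - {w})"
    using finW by (simp add: sum.remove[of W w] ord)
  finally have cardW: "card (W - {w}) = r + s + t - 3" by simp
  have "mset_set W = add_mset w (mset_set (W - {w}))"
    using finW by (metis mset_set.remove)
  moreover have "image_mset (\<lambda>z. order z (P - [:c:])) (mset_set (W - {w})) =
      image_mset (\<lambda>_. 1) (mset_set (W - {w}))"
    using finW(1) by (intro image_mset_cong) (auto simp: ord)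
  ultimately have "image_mset (\<lambda>z. order z (P - [:c:])) (mset_set W) =
      add_mset 3 (replicate_mset (r + s + t - 3) 1)"
    using finW cardW by (simp add: ord image_mset_const_eq)
  then show ?thesis
    using shabat passport_shabat_tree[OF shabat] black deg(1)
    by (simp add: shabat_family_def W_def c_def)
qed

section \<open>Classification up to affine equivalence\<close>

text \<open>Distinct multiplicities force the source map to match the roots in order. Fixing 0 and 1
  it is the identity, so \<open>b\<close> equals \<open>a\<close>.\<close>

lemma shabat_equiv_three_root_poly_imp_eq:
  assumes "r > 0" "s > 0" "t > 0" "r \<noteq> s" "r \<noteq> t" "s \<noteq> t"
    and a: "a \<noteq> 0" "a \<noteq> 1" and b: "b \<noteq> 0" "b \<noteq> 1"
    and equiv: "shabat_equiv (three_root_poly r s t a, 0, c) (three_root_poly r s t b, 0, d)"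
  shows "a = b"
proof -
  \<comment> \<open>The target map has no constant term since both black values are 0.\<close>
  obtain u v w where u: "u \<noteq> 0" and "w \<noteq> 0"
    and eq: "three_root_poly r s t b = smult w (pcompose (three_root_poly r s t a) [:v, u:])"
    using equiv by (auto simp: shabat_equiv_def)
  have "order z (three_root_poly r s t b) = order (v + u * z) (three_root_poly r s t a)" for z
    unfolding eq using u \<open>w \<noteq> 0\<close> by (simp add: order_smult order_pcompose_linear)
  from this[of 0] this[of 1] this[of b] have "v = 0" "v + u = 1" "v + u * b = a"
    using assms(1-10) by (auto simp: order_three_root_poly split: if_splits)
  then show "a = b" by simp
qed

text \<open>Labels the black vertices by their degrees, which is possible because these are
  distinct.\<close>

lemma image_mset_mset_set_eq_triple:
  assumes "image_mset f (mset_set B) = {#r, s, t#}" "finite B" "distinct [r, s, t]"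
  obtains x y z where "B = {x, y, z}" "distinct [x, y, z]" "f x = r" "f y = s" "f z = t"
proof -
  have "f ` B = {r, s, t}"
    using arg_cong[OF assms(1), of set_mset] assms(2) by auto
  then obtain x y z where xyz: "x \<in> B" "y \<in> B" "z \<in> B" "f x = r" "f y = s" "f z = t"
    by (metis imageE insertCI)
  have "card B = 3"
    using arg_cong[OF assms(1), of size] by simp
  moreover have "distinct [x, y, z]" using xyz assms(3) by auto
  ultimately have "{x, y, z} = B"
    using xyz assms(2) by (intro card_subset_eq) auto
  then show ?thesis using that xyz \<open>distinct [x, y, z]\<close> by blast
qed

text \<open>An affine change of variable normalises the black vertices. A white vertex of degree 3
  is a double zero of the derivative away from the black vertices, hence a double root of the
  quadratic factor.\<close>

lemma shabat_family_equiv_three_root_poly: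
  assumes pos: "r > 0" "s > 0" "t > 0" and dist: "distinct [r, s, t]"
    and Q: "(Q, c1, c2) \<in> shabat_family ({#r, s, t#}, add_mset 3 M, n)"
  shows "\<exists>a. white_condition r s t a \<and> shabat_equiv (Q, c1, c2)
    (three_root_poly r s t a, 0, poly (three_root_poly r s t a) (white_point r s t a))"
proof -
  have shabat: "shabat Q c1 c2"
    and black: "image_mset (\<lambda>z. order z (Q - [:c1:])) (mset_set {z. poly Q z = c1}) = {#r, s, t#}"
    and white: "image_mset (\<lambda>z. order z (Q - [:c2:])) (mset_set {z. poly Q z = c2}) = add_mset 3 M"
    using Q passport_shabat_tree[of Q c1 c2] by (auto simp: shabat_family_def)
  have deg: "degree Q > 0" and "c1 \<noteq> c2" using shabat by (auto simp: shabat_def)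
  obtain x y z where xyz: "{z. poly Q z = c1} = {x, y, z}" "distinct [x, y, z]"
    "order x (Q - [:c1:]) = r" "order y (Q - [:c1:]) = s" "order z (Q - [:c1:]) = t"
    by (rule image_mset_mset_set_eq_triple[OF black finite_fibre[OF deg] dist])
  have "3 \<in># image_mset (\<lambda>z. order z (Q - [:c2:])) (mset_set {z. poly Q z = c2})"
    by (simp add: white)
  then obtain q where q: "poly Q q = c2" "order q (Q - [:c2:]) = 3"
    using finite_fibre[OF deg, of c2] by (auto simp: image_iff)
  have order_dQ: "order q (pderiv Q) = 2" using order_minus_const[OF deg q(1)] q(2) by simp
  have "pderiv Q \<noteq> 0" using deg by (simp add: pderiv_eq_0_iff)
  then have dQ: "poly (pderiv Q) q = 0" using order_dQ by (simp add: order_root)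
  then have "order q (pderiv (pderiv Q)) = 1"
    using order_pderiv[OF \<open>pderiv Q \<noteq> 0\<close>, of q] order_dQ by simp
  then have ddQ: "poly (pderiv (pderiv Q)) q = 0" by (simp add: order_root)

  \<comment> \<open>The map sending \<open>v\<close> to \<open>x + u * v\<close> takes 0, 1,
    \<open>a\<close> to \<open>x\<close>, \<open>y\<close>, \<open>z\<close>; the scalar
    \<open>w\<close> cancels \<open>l\<close> and the powers of \<open>u\<close> pulled out of the
    linear factors.\<close>
  define l u a w where "l = lead_coeff (Q - [:c1:])" and "u = y - x"
    and "a = (z - x) / (y - x)" and "w = 1 / (l * u ^ (r + s + t))"
  have "l \<noteq> 0" "u \<noteq> 0"
    using minus_const_nonzero[OF deg, of c1] xyz(2)
    unfolding l_def u_def leading_coeff_0_iff by auto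
  then have "w \<noteq> 0" by (simp add: w_def)
  define P where "P = three_root_poly r s t a"
  have decomp: "Q - [:c1:] = smult l ([:-x, 1:] ^ r * [:-y, 1:] ^ s * [:-z, 1:] ^ t)"
    using complex_poly_decompose[of "Q - [:c1:]"] xyz by (simp add: l_def algebra_simps)
  have Qpoly: "poly Q v - c1 = l * ((v - x) ^ r * (v - y) ^ s * (v - z) ^ t)" for v
    using arg_cong[OF decomp, of "\<lambda>p. poly p v"] by simp
  have Ppoly: "poly P v = w * (poly Q (x + u * v) - c1)" for v
  proof -
    have "x + u * v - x = u * v" "x + u * v - y = u * (v - 1)" "x + u * v - z = u * (v - a)"
      using \<open>u \<noteq> 0\<close> by (simp_all add: u_def a_def field_simps)
    then show ?thesis
      using \<open>l \<noteq> 0\<close> \<open>u \<noteq> 0\<close>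
      by (simp add: P_def poly_three_root_poly Qpoly w_def power_mult_distrib power_add)
  qed
  have P: "P = smult w (pcompose Q [:x, u:]) + [:- w * c1:]"
    by (intro poly_eq_poly_eq_iff[THEN iffD1] ext)
       (simp add: Ppoly poly_pcompose algebra_simps)
  define p where "p = (q - x) / u"
  have p: "x + u * p = q" using \<open>u \<noteq> 0\<close> by (simp add: p_def)
  have "pderiv P = smult (w * u) (pcompose (pderiv Q) [:x, u:])"
    by (simp add: P pderiv_add pderiv_smult pderiv_pcompose pderiv_pCons)
  moreover from this have "pderiv (pderiv P) = smult (w * u * u) (pcompose (pderiv (pderiv Q)) [:x, u:])"
    by (simp add: pderiv_smult pderiv_pcompose pderiv_pCons)
  ultimately have dP: "poly (pderiv P) p = 0" "poly (pderiv (pderiv P)) p = 0"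
    using dQ ddQ p by (simp_all add: poly_pcompose mult.commute)
  have Pp: "poly P p = w * (c2 - c1)" by (simp add: Ppoly p q(1))
  then have "poly P p \<noteq> 0" using \<open>w \<noteq> 0\<close> \<open>c1 \<noteq> c2\<close> by simp
  \<comment> \<open>As \<open>p\<close> is not black, the cofactor of the quadratic is nonzero
    there, so both vanishing derivatives of \<open>P\<close> pass to the quadratic.\<close>
  then have nz: "poly (three_root_poly (r - 1) (s - 1) (t - 1) a) p \<noteq> 0"
    using pos by (auto simp: P_def poly_three_root_poly)
  have fac: "pderiv P = three_root_poly (r - 1) (s - 1) (t - 1) a * white_quadratic r s t a"
    unfolding P_def by (rule pderiv_three_root_poly[OF pos])
  have wq: "poly (white_quadratic r s t a) p = 0"
    using dP(1) nz by (simp add: fac)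
  then have "poly (pderiv (white_quadratic r s t a)) p = 0"
    using dP(2) nz by (simp add: fac pderiv_mult)
  from white_quadratic_double_root[OF pos(1) wq this]
  have "white_condition r s t a" "p = white_point r s t a" .
  moreover have "shabat_equiv (Q, c1, c2) (P, 0, poly P p)"
    unfolding shabat_equiv_def prod.case
    by (rule exI[of _ u], rule exI[of _ x], rule exI[of _ w], rule exI[of _ "- w * c1"])
       (use P Pp \<open>u \<noteq> 0\<close> \<open>w \<noteq> 0\<close> in \<open>simp add: algebra_simps\<close>)
  ultimately show ?thesis unfolding P_def by blast
qed

theorem lemma3p1:
  fixes r s t n :: nat
  assumes "r > 0" "s > 0" "t > 0"
    and "r \<noteq> s" "r \<noteq> t" "s \<noteq> t"
    and "n = r + s + t"
  shows "\<exists>c2 c2'.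
    (let F = shabat_family ({#r, s, t#}, add_mset 3 (replicate_mset (n - 3) 1), n);
         P = (three_root_poly r s t (third_root (-1) r s t), 0, c2);
         P' = (three_root_poly r s t (third_root 1 r s t), 0, c2')
     in P \<in> F \<and> P' \<in> F \<and> \<not> shabat_equiv P P' \<and>
        (\<forall>Q \<in> F. shabat_equiv Q P \<or> shabat_equiv Q P'))"
proof -
  define F where "F = shabat_family ({#r, s, t#}, add_mset 3 (replicate_mset (n - 3) 1), n)"
  \<comment> \<open>The white critical value is the value at the double root of the quadratic
    factor; it supplies both witnesses.\<close>
  define c where "c = (\<lambda>a. poly (three_root_poly r s t a) (white_point r s t a))"
  define a a' where "a = third_root (-1) r s t" and "a' = third_root 1 r s t"
  have iff: "white_condition r s t b \<longleftrightarrow> b = a \<or> b = a'" for b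
    unfolding a_def a'_def by (rule white_condition_iff[OF assms(1)])
  then have cond: "white_condition r s t a" "white_condition r s t a'" by auto
  have "(three_root_poly r s t b, 0, c b) \<in> F" if "white_condition r s t b" for b
    using three_root_poly_in_family[OF assms(1-3) that] by (simp add: F_def c_def assms(7))
  moreover have "\<not> shabat_equiv (three_root_poly r s t a, 0, c a) (three_root_poly r s t a', 0, c a')"
    using shabat_equiv_three_root_poly_imp_eq[OF assms(1-6)] third_roots_distinct[OF assms(1-3)]
      white_condition_nondegenerate[OF assms(1,2)] cond
    unfolding a_def a'_def by blast
  moreover have "shabat_equiv Q (three_root_poly r s t a, 0, c a) \<or>
      shabat_equiv Q (three_root_poly r s t a', 0, c a')" if "Q \<in> F" for Q
  proof -
    obtain Q' c1 c2 where Q: "Q = (Q', c1, c2)" by (cases Q)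
    have "distinct [r, s, t]" using assms(4-6) by simp
    from shabat_family_equiv_three_root_poly[OF assms(1-3) this] that Q iff
    show ?thesis unfolding F_def c_def by metis
  qed
  ultimately show ?thesis
    using cond unfolding Let_def F_def a_def a'_def by blast
qed

end
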